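(* Let $A_0,A_1,\dots,A_n\in\mathbb{R}^d$ with $A_{k+1}\ne A_k$ for $0\le k\le n-1$, and let $\alpha=A_0A_1\dots A_n$ be the broken line with these successive vertices. Put $c_k=|A_{k+1}-A_k|$ and $p_k=\pi\left(\frac{A_{k+1}-A_k}{|A_{k+1}-A_k|}\right)\in P^{d-1}$. Then $$\mu_\alpha=\sum_{k=0}^{n-1}c_k\,\delta_{p_k}.$$
   Context: $P^{d-1}$ is real projective space of dimension $d-1$, and $\pi:S^{d-1}\to P^{d-1}$ is the projection identifying antipodal points. $\delta_p$ is the unit point mass at $p$. The broken line $A_0A_1\dots A_n$ is the piecewise linear curve $\alpha:[0,1]\to\mathbb{R}^d$ obtained by concatenating the segments from $A_k$ to $A_{k+1}$: there is a partition $0=t_0<t_1<\dots<t_n=1$ such that $\alpha(t_k)=A_k$ and $\alpha$ is affine on each $[t_k,t_{k+1}]$. For $f\in C(P^{d-1})$, $\hat f:\mathbb{R}^d\to\mathbb{R}$ denotes the degree $1$ homogeneous extension $\hat f(r\xi)=|r|\,f(\pi(\xi))$ for $r\in\mathbb{R}$, $\xi\in S^{d-1}$. For an absolutely continuous curve $\alpha:[0,1]\to\mathbb{R}^d$, $\mu_\alpha$ is the unique finite positive Borel measure on $P^{d-1}$ with $\int f\,d\mu_\alpha=\int_0^1\hat f(\alpha'(t))\,dt$ for all $f\in C(P^{d-1})$. *)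

theory Defs
  imports "HOL-Probability.Giry_Monad"
begin

text \<open>
  The projective space of a Euclidean space of dimension \<open>d\<close> is the quotient of the
  unit sphere by the antipodal map. The quotient is partial: \<open>abs_proj_space\<close> is
  meaningful on unit vectors only, where it is the projection identifying antipodes.
\<close>

quotient_type (overloaded) 'a proj_space =
  "'a::euclidean_space" / partial: "\<lambda>x y. norm x = 1 \<and> norm y = 1 \<and> (x = y \<or> x = - y)"
proof (rule part_equivpI)
  obtain b :: 'a where "b \<in> Basis"
    using nonempty_Basis by blast
  then show "\<exists>x::'a. norm x = 1 \<and> norm x = 1 \<and> (x = x \<or> x = - x)"
    by (intro exI[of _ b]) simp
qed (auto intro!: sympI transpI)

definition to_proj :: "'a::euclidean_space \<Rightarrow> 'a proj_space"
  where "to_proj x = abs_proj_space x"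

lemma to_proj_eq_iff:
  assumes "norm x = 1" "norm y = 1"
  shows "to_proj x = to_proj y \<longleftrightarrow> x = y \<or> x = - y"
  using Quotient_rel[OF Quotient_proj_space, of x y] assms by (auto simp: to_proj_def)

lemma to_proj_surj: "\<exists>x. norm x = 1 \<and> to_proj x = p"
  unfolding to_proj_def
  using Quotient_abs_rep[OF Quotient_proj_space, of p]
    Quotient_rep_reflp[OF Quotient_proj_space, of p] by blast

instantiation proj_space :: (euclidean_space) topological_space
begin

definition open_proj_space :: "'a proj_space set \<Rightarrow> bool"
  where "open_proj_space U \<longleftrightarrow>
    openin (top_of_set (sphere 0 1)) {x \<in> sphere 0 1. to_proj x \<in> U}"

instance
proof
  show "open (UNIV :: 'a proj_space set)"
  proof -
    have "{x \<in> sphere (0::'a) 1. to_proj x \<in> UNIV} = sphere 0 1"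
      by auto
    moreover have "openin (top_of_set (sphere (0::'a) 1)) (sphere 0 1)"
      by (rule openin_subtopology_self)
    ultimately show ?thesis
      unfolding open_proj_space_def by argo
  qed
next
  fix U V :: "'a proj_space set"
  assume "open U" "open V"
  then have "openin (top_of_set (sphere 0 1))
      ({x \<in> sphere 0 1. to_proj x \<in> U} \<inter> {x \<in> sphere 0 1. to_proj x \<in> V})"
    unfolding open_proj_space_def by (rule openin_Int)
  moreover have "{x \<in> sphere 0 1. to_proj x \<in> U} \<inter> {x \<in> sphere 0 1. to_proj x \<in> V} =
      {x \<in> sphere 0 1. to_proj x \<in> U \<inter> V}"
    by blast
  ultimately show "open (U \<inter> V)"
    unfolding open_proj_space_def by argo
next
  fix \<U> :: "'a proj_space set set"
  assume "\<forall>U\<in>\<U>. open U"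
  then have "openin (top_of_set (sphere 0 1)) (\<Union>U\<in>\<U>. {x \<in> sphere 0 1. to_proj x \<in> U})"
    unfolding open_proj_space_def by (intro openin_Union) blast
  moreover have "(\<Union>U\<in>\<U>. {x \<in> sphere 0 1. to_proj x \<in> U}) =
      {x \<in> sphere 0 1. to_proj x \<in> \<Union>\<U>}"
    by blast
  ultimately show "open (\<Union>\<U>)"
    unfolding open_proj_space_def by argo
qed

end

definition hom_ext :: "('a::euclidean_space proj_space \<Rightarrow> real) \<Rightarrow> 'a \<Rightarrow> real"
  where "hom_ext f v = norm v * f (to_proj (v /\<^sub>R norm v))"

lemma hom_ext_scaleR:
  assumes "norm x = 1"
  shows "hom_ext f (r *\<^sub>R x) = \<bar>r\<bar> * f (to_proj x)"
proof -
  consider "r = 0" | "r > 0" | "r < 0"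
    by linarith
  then show ?thesis
  proof cases
    case 3
    have "to_proj (- x) = to_proj x"
      using to_proj_eq_iff[of "- x" x] assms by simp
    then show ?thesis
      using assms 3 by (simp add: hom_ext_def)
  qed (use assms in \<open>simp_all add: hom_ext_def\<close>)
qed

text \<open>
  Only the restriction of \<open>\<alpha>\<close> to \<open>[0,1]\<close> matters. For absolutely continuous \<open>\<alpha>\<close> the
  derivative exists almost everywhere, and its unspecified values elsewhere do not
  affect the integral, which is taken with respect to the completed Lebesgue measure.
\<close>

definition curve_measure :: "(real \<Rightarrow> 'a::euclidean_space) \<Rightarrow> 'a proj_space measure"
  where "curve_measure \<alpha> = (THE \<mu>. sets \<mu> = sets borel \<and> finite_measure \<mu> \<and>
    (\<forall>f. continuous_on UNIV f \<longrightarrow>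
      (LINT p|\<mu>. f p) =
      (LINT t:{0..1}|lebesgue. hom_ext f (vector_derivative \<alpha> (at t within {0..1})))))"

definition broken_line :: "nat \<Rightarrow> (nat \<Rightarrow> 'a::real_vector) \<Rightarrow> (real \<Rightarrow> 'a) \<Rightarrow> bool"
  where "broken_line n A \<alpha> \<longleftrightarrow> (\<exists>t. t 0 = 0 \<and> t n = 1 \<and>
    (\<forall>k<n. t k < t (Suc k)) \<and>
    (\<forall>k\<le>n. \<alpha> (t k) = A k) \<and>
    (\<forall>k<n. \<exists>a b. \<forall>s\<in>{t k..t (Suc k)}. \<alpha> s = a + s *\<^sub>R b))"

definition sum_measure :: "'a measure \<Rightarrow> ('i \<Rightarrow> 'a measure) \<Rightarrow> 'i set \<Rightarrow> 'a measure"
  where "sum_measure M N I =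
    measure_of (space M) (sets M) (\<lambda>B. \<Sum>i\<in>I. emeasure (N i) B)"

lemma space_sum_measure [simp]: "space (sum_measure M N I) = space M"
  and sets_sum_measure [simp]: "sets (sum_measure M N I) = sets M"
  by (simp_all add: sum_measure_def)

lemma emeasure_sum_measure:
  assumes "\<And>i. i \<in> I \<Longrightarrow> sets (N i) = sets M" and B: "B \<in> sets M"
  shows "emeasure (sum_measure M N I) B = (\<Sum>i\<in>I. emeasure (N i) B)"
  unfolding sum_measure_def
proof (rule emeasure_measure_of_sigma)
  show "sigma_algebra (space M) (sets M)"
    by (rule sets.sigma_algebra_axioms)
  show "positive (sets M) (\<lambda>B. \<Sum>i\<in>I. emeasure (N i) B)"
    by (simp add: positive_def)
  show "countably_additive (sets M) (\<lambda>B. \<Sum>i\<in>I. emeasure (N i) B)"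
  proof (rule countably_additiveI)
    fix X :: "nat \<Rightarrow> _"
    assume X: "range X \<subseteq> sets M" "disjoint_family X"
    have "(\<Sum>j. emeasure (N i) (X j)) = emeasure (N i) (\<Union>j. X j)" if "i \<in> I" for i
      by (rule suminf_emeasure) (use X assms(1)[OF that] in simp_all)
    then have "(\<Sum>i\<in>I. \<Sum>j. emeasure (N i) (X j)) = (\<Sum>i\<in>I. emeasure (N i) (\<Union>j. X j))"
      by (rule sum.cong[OF refl])
    moreover have "(\<Sum>j. \<Sum>i\<in>I. emeasure (N i) (X j)) = (\<Sum>i\<in>I. \<Sum>j. emeasure (N i) (X j))"
      by (rule suminf_sum) (rule summableI)
    ultimately show "(\<Sum>j. \<Sum>i\<in>I. emeasure (N i) (X j)) = (\<Sum>i\<in>I. emeasure (N i) (\<Union>j. X j))"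
      by (rule trans[rotated])
  qed
qed (rule B)

end

theory Submission imports Defs begin

text \<open>
  Two things are needed: the right-hand side has the property that characterises
  \<open>curve_measure \<alpha>\<close>, and at most one measure has it.

  The first is a direct computation. Inside the \<open>k\<close>-th parameter interval the derivative of
  \<open>\<alpha>\<close> is the constant vector \<open>(A (Suc k) - A k) / (t (Suc k) - t k)\<close>. Because \<open>hom_ext f\<close> is
  positively homogeneous of degree one, the length of the interval cancels, and the interval
  contributes \<open>hom_ext f (A (Suc k) - A k) = c k * f (p k)\<close>, whatever the partition. The
  breakpoints form a finite set and do not matter. On the other side, a finite sum of weighted
  point masses is the image under \<open>p\<close> of the measure on the index set with weights \<open>c\<close>
  (\<open>sum_measure_return_eq_distr\<close>), so that its integral of \<open>f\<close> is \<open>\<Sum>k<n. c k * f (p k)\<close>.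

  For uniqueness, every closed subset \<open>C\<close> of projective space is exactly the set where some
  continuous function \<open>f\<close> with values in \<open>[0,1]\<close> equals \<open>1\<close>
  (\<open>closed_proj_space_peak_function\<close>). The powers of \<open>f\<close> decrease to the indicator of \<open>C\<close>, so by
  dominated convergence the integrals of continuous functions determine the measure of every
  closed set. Closed sets form an intersection-stable generator of the Borel sets, and hence
  determine a finite measure (\<open>finite_borel_measure_eqI_continuous\<close>).
\<close>

section \<open>Continuous functions on projective space\<close>

text \<open>The universal property of the quotient topology, in which a set is open when the
  set of unit vectors over it is.\<close>

lemma continuous_on_proj_space_iff:
  fixes f :: "'a::euclidean_space proj_space \<Rightarrow> 'b::topological_space"
  shows "continuous_on UNIV f \<longleftrightarrow> continuous_on (sphere 0 1) (\<lambda>x. f (to_proj x))"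
proof -
  have "{x \<in> sphere 0 1. to_proj x \<in> f -` B} = sphere 0 1 \<inter> (\<lambda>x. f (to_proj x)) -` B" for B
    by auto
  then have "open (f -` B) \<longleftrightarrow>
      openin (top_of_set (sphere 0 1)) (sphere 0 1 \<inter> (\<lambda>x. f (to_proj x)) -` B)" for B
    unfolding open_proj_space_def by presburger
  then show ?thesis
    by (simp add: continuous_on_open_vimage continuous_on_open_gen[of _ _ UNIV]
        continuous_openin_preimage_eq)
qed

lemma even_function_factors_through_to_proj:
  fixes g :: "'a::euclidean_space \<Rightarrow> 'b"
  assumes "\<And>x. norm x = 1 \<Longrightarrow> g (- x) = g x"
  obtains f where "\<And>x. norm x = 1 \<Longrightarrow> f (to_proj x) = g x"
proof
  fix x :: 'a
  assume x: "norm x = 1"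
  define y where "y = (SOME y. norm y = 1 \<and> to_proj y = to_proj x)"
  have "norm y = 1 \<and> to_proj y = to_proj x"
    unfolding y_def by (rule someI[of _ x]) (use x in simp)
  then have "y = x \<or> y = - x"
    using to_proj_eq_iff[of y x] x by blast
  then show "(\<lambda>p. g (SOME y. norm y = 1 \<and> to_proj y = p)) (to_proj x) = g x"
    using assms x y_def by auto
qed

lemma closed_vimage_to_proj:
  fixes C :: "'a::euclidean_space proj_space set"
  assumes "closed C"
  shows "closed {x \<in> sphere 0 1. to_proj x \<in> C}"
proof -
  have "openin (top_of_set (sphere 0 1)) {x \<in> sphere (0::'a) 1. to_proj x \<in> - C}"
    using assms by (simp add: closed_def open_proj_space_def)
  also have "{x \<in> sphere (0::'a) 1. to_proj x \<in> - C} =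
      sphere 0 1 - {x \<in> sphere 0 1. to_proj x \<in> C}"
    by auto
  finally have "closedin (top_of_set (sphere 0 1)) {x \<in> sphere (0::'a) 1. to_proj x \<in> C}"
    by (auto simp: closedin_def)
  then show ?thesis
    by (rule closedin_closed_trans) simp
qed

text \<open>
  With \<open>K\<close> the set of unit vectors over \<open>C\<close>, the function \<open>1 / (1 + d)\<close> is as wanted, where
  \<open>d x\<close> is the sum of the distances of \<open>x\<close> and \<open>- x\<close> from \<open>K\<close>. Adding the two distances makes
  \<open>d\<close> even for free, so that it descends to the quotient.
\<close>

lemma closed_proj_space_peak_function:
  fixes C :: "'a::euclidean_space proj_space set"
  assumes "closed C"
  shows "\<exists>f :: 'a proj_space \<Rightarrow> real. continuous_on UNIV f \<and>
    (\<forall>p. 0 \<le> f p \<and> f p \<le> 1 \<and> (f p = 1 \<longleftrightarrow> p \<in> C))"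
proof (cases "C = {}")
  case True
  then show ?thesis
    by (intro exI[of _ "\<lambda>_. 0"]) simp
next
  case False
  define K where "K = {x \<in> sphere (0::'a) 1. to_proj x \<in> C}"
  have "K \<noteq> {}"
    using False to_proj_surj unfolding K_def by (metis (mono_tags, lifting) Collect_empty_eq
        all_not_in_conv mem_sphere_0)
  moreover have "closed K"
    unfolding K_def by (rule closed_vimage_to_proj) fact
  ultimately have infdist_0: "infdist x K = 0 \<longleftrightarrow> x \<in> K" for x
    using in_closed_iff_infdist_zero by blast
  define d where "d x = infdist x K + infdist (- x) K" for x
  have d_nonneg: "d x \<ge> 0" for x
    by (simp add: d_def infdist_nonneg)
  have d_0: "d x = 0 \<longleftrightarrow> to_proj x \<in> C" if "norm x = 1" for x
  proof -
    have "to_proj (- x) = to_proj x"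
      using that by (simp add: to_proj_eq_iff)
    then show ?thesis
      using that by (simp add: d_def add_nonneg_eq_0_iff infdist_nonneg infdist_0)
        (simp add: K_def)
  qed
  obtain f where f: "\<And>x. norm x = 1 \<Longrightarrow> f (to_proj x) = 1 / (1 + d x)"
    by (rule even_function_factors_through_to_proj[of "\<lambda>x. 1 / (1 + d x)"])
      (simp add: d_def add.commute, rule that)
  have "continuous_on (sphere 0 1) d"
    unfolding d_def by (intro continuous_intros)
  moreover have "1 + d x \<noteq> 0" for x
    using d_nonneg[of x] by linarith
  ultimately have "continuous_on (sphere 0 1) (\<lambda>x. 1 / (1 + d x))"
    by (intro continuous_intros) simp_all
  then have "continuous_on UNIV f"
    unfolding continuous_on_proj_space_iff by (rule continuous_on_eq) (simp add: f)
  moreover have "0 \<le> f p \<and> f p \<le> 1 \<and> (f p = 1 \<longleftrightarrow> p \<in> C)" for p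
  proof -
    obtain x where x: "norm x = 1" and p: "p = to_proj x"
      using to_proj_surj by metis
    show ?thesis
      unfolding p f[OF x] using d_0[OF x] d_nonneg[of x] by (simp add: divide_simps)
  qed
  ultimately show ?thesis
    by blast
qed

section \<open>Finite measures are determined by integrals of continuous functions\<close>

lemma finite_borel_measure_eqI_continuous:
  fixes M N :: "'a::topological_space measure"
  assumes "finite_measure M" "finite_measure N"
    and [measurable_cong, simp]: "sets M = sets borel" "sets N = sets borel"
    and integral_eq: "\<And>f :: 'a \<Rightarrow> real. continuous_on UNIV f \<Longrightarrow> (LINT x|M. f x) = (LINT x|N. f x)"
    and peak: "\<And>C :: 'a set. closed C \<Longrightarrow> \<exists>f :: 'a \<Rightarrow> real. continuous_on UNIV f \<and>
      (\<forall>x. 0 \<le> f x \<and> f x \<le> 1 \<and> (f x = 1 \<longleftrightarrow> x \<in> C))"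
  shows "M = N"
proof -
  interpret M: finite_measure M by fact
  interpret N: finite_measure N by fact
  have closed_eq: "emeasure M C = emeasure N C" if C: "closed C" for C
  proof -
    obtain f :: "'a \<Rightarrow> real" where cont: "continuous_on UNIV f"
      and f: "\<And>x. 0 \<le> f x" "\<And>x. f x \<le> 1" "\<And>x. f x = 1 \<longleftrightarrow> x \<in> C"
      using peak[OF C] by blast
    have [measurable]: "f \<in> borel_measurable borel"
      by (rule borel_measurable_continuous_onI) fact
    have [measurable]: "C \<in> sets borel"
      using C by simp
    have lim: "(\<lambda>m. f x ^ m) \<longlonglongrightarrow> indicator C x" for x
    proof (cases "x \<in> C")
      case False
      then have "f x < 1"
        using f(2,3)[of x] by linarith
      then show ?thesis
        using False f(1)[of x] LIMSEQ_realpow_zero by simp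
    qed (use f(3)[of x] in simp)
    have lim_integral: "(\<lambda>m. LINT x|L. f x ^ m) \<longlonglongrightarrow> measure L C"
      if L: "finite_measure L" and [measurable_cong, simp]: "sets L = sets borel" for L
    proof -
      interpret finite_measure L by (rule L)
      have [simp]: "space L = UNIV"
        using sets_eq_imp_space_eq[OF that(2)] by simp
      have "(\<lambda>m. LINT x|L. f x ^ m) \<longlonglongrightarrow> (LINT x|L. indicator C x)"
        by (rule integral_dominated_convergence[where w = "\<lambda>_. 1"])
          (use lim f(1,2) in \<open>simp_all add: power_le_one\<close>)
      then show ?thesis
        by simp
    qed
    have "(LINT x|M. f x ^ m) = (LINT x|N. f x ^ m)" for m
      by (intro integral_eq continuous_intros cont)
    then have "measure M C = measure N C"
      using LIMSEQ_unique lim_integral[of M] lim_integral[of N] assms(1,2) by simp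
    then show ?thesis
      by (simp add: M.emeasure_eq_measure N.emeasure_eq_measure)
  qed
  show ?thesis
  proof (rule measure_eqI_generator_eq[where \<Omega> = UNIV and E = "Collect closed" and A = "\<lambda>_. UNIV"])
    show "Int_stable (Collect closed :: 'a set set)"
      by (auto simp: Int_stable_def)
    show "sets M = sigma_sets UNIV (Collect closed)" "sets N = sigma_sets UNIV (Collect closed)"
      by (simp_all add: borel_eq_closed)
  qed (auto simp: closed_eq)
qed

section \<open>Sums of point masses\<close>

lemma sum_measure_return_eq_distr:
  fixes p :: "'i \<Rightarrow> 'a::topological_space"
  assumes "finite I"
  shows "sum_measure borel (\<lambda>i. scale_measure (c i) (return borel (p i))) I =
    distr (point_measure I c) borel p"
proof (rule measure_eqI)
  fix B assume "B \<in> sets (sum_measure borel (\<lambda>i. scale_measure (c i) (return borel (p i))) I)"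
  then have B: "B \<in> sets borel"
    by simp
  have "emeasure (distr (point_measure I c) borel p) B =
      emeasure (point_measure I c) {i \<in> I. p i \<in> B}"
    using B by (subst emeasure_distr)
      (auto simp: space_point_measure measurable_point_measure_eq1
        intro!: arg_cong[where f = "emeasure _"])
  also have "\<dots> = (\<Sum>i | i \<in> I \<and> p i \<in> B. c i)"
    using assms by (intro emeasure_point_measure_finite) auto
  also have "\<dots> = (\<Sum>i\<in>I. c i * indicator B (p i))"
    using assms by (simp add: indicator_def sum.If_cases Collect_conj_eq)
  finally show "emeasure (sum_measure borel (\<lambda>i. scale_measure (c i) (return borel (p i))) I) B =
      emeasure (distr (point_measure I c) borel p) B"
    using B by (simp add: emeasure_sum_measure)
qed simp

lemma integral_sum_measure_return:
  fixes f :: "'a::topological_space \<Rightarrow> real"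
  assumes "finite I" "\<And>i. i \<in> I \<Longrightarrow> 0 \<le> c i" and [measurable]: "f \<in> borel_measurable borel"
  shows "(LINT x|sum_measure borel (\<lambda>i. scale_measure (ennreal (c i)) (return borel (p i))) I. f x)
    = (\<Sum>i\<in>I. c i * f (p i))"
  using assms
  by (simp add: sum_measure_return_eq_distr integral_distr measurable_point_measure_eq1
      lebesgue_integral_point_measure_finite)

lemma finite_measure_sum_measure_return:
  fixes p :: "'i \<Rightarrow> 'a::topological_space"
  assumes "finite I"
  shows "finite_measure (sum_measure borel (\<lambda>i. scale_measure (ennreal (c i)) (return borel (p i))) I)"
  by (rule finite_measureI) (simp add: emeasure_sum_measure ennreal_mult_eq_top_iff assms)

section \<open>Integration along the broken line\<close>

lemma has_integral_piecewise_constant: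
  fixes G :: "real \<Rightarrow> 'b::banach"
  assumes "\<And>k. k < m \<Longrightarrow> t k < t (Suc k)"
    and "\<And>k s. k < m \<Longrightarrow> t k < s \<Longrightarrow> s < t (Suc k) \<Longrightarrow> G s = g k"
  shows "(G has_integral (\<Sum>k<m. (t (Suc k) - t k) *\<^sub>R g k)) {t 0..t m} \<and> t 0 \<le> t m"
  using assms
proof (induction m)
  case (Suc m)
  have "((\<lambda>_. g m) has_integral (t (Suc m) - t m) *\<^sub>R g m) {t m..t (Suc m)}"
    using Suc.prems(1)[of m] has_integral_const_real[of "g m" "t m" "t (Suc m)"] by simp
  then have "(G has_integral (t (Suc m) - t m) *\<^sub>R g m) {t m..t (Suc m)}"
    by (rule has_integral_spike_interior[of _ _ "t m" "t (Suc m)", simplified])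
      (use Suc.prems(2)[of m] in auto)
  moreover have "(G has_integral (\<Sum>k<m. (t (Suc k) - t k) *\<^sub>R g k)) {t 0..t m} \<and> t 0 \<le> t m"
    using Suc by simp
  ultimately show ?case
    using Suc.prems(1)[of m] has_integral_combine[of "t 0" "t m" "t (Suc m)" G] by auto
qed (simp add: has_integral_refl)

text \<open>
  Applying the previous lemma to the norm as well makes the gauge integral absolutely
  convergent, so that it is a Lebesgue integral.
\<close>

lemma set_lebesgue_integral_piecewise_constant:
  fixes G :: "real \<Rightarrow> 'b::euclidean_space"
  assumes "\<And>k. k < m \<Longrightarrow> t k < t (Suc k)"
    and "\<And>k s. k < m \<Longrightarrow> t k < s \<Longrightarrow> s < t (Suc k) \<Longrightarrow> G s = g k"
  shows "(LINT s:{t 0..t m}|lebesgue. G s) = (\<Sum>k<m. (t (Suc k) - t k) *\<^sub>R g k)"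
proof -
  have G: "(G has_integral (\<Sum>k<m. (t (Suc k) - t k) *\<^sub>R g k)) {t 0..t m}"
    using has_integral_piecewise_constant assms by blast
  have "(\<lambda>s. norm (G s)) integrable_on {t 0..t m}"
    using has_integral_piecewise_constant[of m t "\<lambda>s. norm (G s)" "\<lambda>k. norm (g k)"] assms
    by (auto simp: integrable_on_def)
  then have "G absolutely_integrable_on {t 0..t m}"
    using G by (intro absolutely_integrable_onI) auto
  then show ?thesis
    using G set_lebesgue_integral_eq_integral(2) integral_unique by metis
qed

lemma vector_derivative_within_unit_interval_affine:
  fixes \<alpha> :: "real \<Rightarrow> 'a::real_normed_vector"
  assumes affine: "\<And>s. s \<in> {u..v} \<Longrightarrow> \<alpha> s = a + s *\<^sub>R b"
    and "{u..v} \<subseteq> {0..1}" "u < s" "s < v"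
  shows "vector_derivative \<alpha> (at s within {0..1}) = b"
proof -
  have "((\<lambda>s. a + s *\<^sub>R b) has_vector_derivative b) (at s)"
    by (auto intro!: derivative_eq_intros)
  then have "(\<alpha> has_vector_derivative b) (at s)"
    by (rule has_vector_derivative_transform_within_open[where S = "{u<..<v}"])
      (use assms in auto)
  then have "(\<alpha> has_vector_derivative b) (at s within {0..1})"
    by (rule has_vector_derivative_at_within)
  moreover have "s \<in> {0..1}"
    using assms(2-4) by (meson atLeastAtMost_iff less_imp_le subsetD)
  ultimately show ?thesis
    by (intro vector_derivative_within_cbox[where a = 0 and b = 1, simplified]) auto
qed

lemma hom_ext_scaleR_abs: "hom_ext f (r *\<^sub>R v) = \<bar>r\<bar> * hom_ext f v"
proof (cases "v = 0")
  case False
  then have u: "norm (v /\<^sub>R norm v) = 1" by simp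
  have "r *\<^sub>R v = (r * norm v) *\<^sub>R (v /\<^sub>R norm v)"
    using False by simp
  then show ?thesis
    using hom_ext_scaleR[OF u] by (simp only: hom_ext_def[of f v] abs_mult abs_norm_cancel mult.assoc)
qed (simp add: hom_ext_def)

lemma integral_hom_ext_broken_line:
  fixes A :: "nat \<Rightarrow> 'a::euclidean_space"
  assumes "broken_line n A \<alpha>"
  shows "(LINT s:{0..1}|lebesgue. hom_ext f (vector_derivative \<alpha> (at s within {0..1}))) =
    (\<Sum>k<n. hom_ext f (A (Suc k) - A k))"
proof -
  obtain t a b where t: "t 0 = 0" "t n = 1" "\<And>k. k < n \<Longrightarrow> t k < t (Suc k)"
    and vertex: "\<And>k. k \<le> n \<Longrightarrow> \<alpha> (t k) = A k"
    and affine: "\<And>k s. k < n \<Longrightarrow> s \<in> {t k..t (Suc k)} \<Longrightarrow> \<alpha> s = a k + s *\<^sub>R b k"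
    using assms unfolding broken_line_def by metis
  have t_mono: "t i \<le> t j" if "i \<le> j" "j \<le> n" for i j
    using that
  proof (induction j rule: dec_induct)
    case (step j)
    then show ?case
      using t(3)[of j] by simp
  qed simp
  have range: "{t k..t (Suc k)} \<subseteq> {0..1}" if "k < n" for k
    using t_mono[of 0 k] t_mono[of "Suc k" n] that t(1,2) by simp
  have "(LINT s:{t 0..t n}|lebesgue. hom_ext f (vector_derivative \<alpha> (at s within {0..1}))) =
      (\<Sum>k<n. (t (Suc k) - t k) *\<^sub>R hom_ext f (b k))"
  proof (rule set_lebesgue_integral_piecewise_constant)
    fix k s assume k: "k < n" and s: "t k < s" "s < t (Suc k)"
    have "vector_derivative \<alpha> (at s within {0..1}) = b k"
      using affine[OF k] range[OF k] s by (rule vector_derivative_within_unit_interval_affine)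
    then show "hom_ext f (vector_derivative \<alpha> (at s within {0..1})) = hom_ext f (b k)"
      by simp
  qed (rule t(3))
  also have "\<dots> = (\<Sum>k<n. hom_ext f (A (Suc k) - A k))"
  proof (rule sum.cong[OF refl])
    fix k assume "k \<in> {..<n}"
    then have k: "k < n"
      by simp
    have "A (Suc k) - A k = (t (Suc k) - t k) *\<^sub>R b k"
      using affine[OF k, of "t k"] affine[OF k, of "t (Suc k)"] vertex[of k] vertex[of "Suc k"]
        t(3)[OF k] k by (simp add: scaleR_diff_left)
    then show "(t (Suc k) - t k) *\<^sub>R hom_ext f (b k) = hom_ext f (A (Suc k) - A k)"
      using t(3)[OF k] by (simp add: hom_ext_scaleR_abs)
  qed
  finally show ?thesis
    by (simp add: t(1,2))
qed

section \<open>The measure of a broken line\<close>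

theorem proposition2:
  fixes n :: nat and A :: "nat \<Rightarrow> real ^ 'd" and \<alpha> :: "real \<Rightarrow> real ^ 'd"
    and c :: "nat \<Rightarrow> real" and p :: "nat \<Rightarrow> (real ^ 'd) proj_space"
  assumes "\<And>k. k < n \<Longrightarrow> A (Suc k) \<noteq> A k"
    and "broken_line n A \<alpha>"
    and "\<And>k. k < n \<Longrightarrow> c k = norm (A (Suc k) - A k)"
    and "\<And>k. k < n \<Longrightarrow> p k = to_proj ((A (Suc k) - A k) /\<^sub>R norm (A (Suc k) - A k))"
  shows "curve_measure \<alpha> =
    sum_measure borel (\<lambda>k. scale_measure (ennreal (c k)) (return borel (p k))) {..<n}"
  (is "_ = ?S")
proof -
  have S: "sets ?S = sets borel" "finite_measure ?S"
    by (simp_all add: finite_measure_sum_measure_return)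
  have S_integral: "(LINT q|?S. f q) =
      (LINT s:{0..1}|lebesgue. hom_ext f (vector_derivative \<alpha> (at s within {0..1})))"
    if "continuous_on UNIV f" for f
  proof -
    have "(LINT q|?S. f q) = (\<Sum>k<n. c k * f (p k))"
      using that assms(3)
      by (intro integral_sum_measure_return borel_measurable_continuous_onI) simp_all
    also have "\<dots> = (\<Sum>k<n. hom_ext f (A (Suc k) - A k))"
      using assms(3,4) by (simp add: hom_ext_def)
    finally show ?thesis
      using assms(2) by (simp add: integral_hom_ext_broken_line)
  qed
  show ?thesis
    unfolding curve_measure_def
  proof (rule the_equality)
    fix \<mu> :: "(real ^ 'd) proj_space measure"
    assume "sets \<mu> = sets borel \<and> finite_measure \<mu> \<and> (\<forall>f. continuous_on UNIV f \<longrightarrow> (LINT p|\<mu>. f p) =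
      (LINT t:{0..1}|lebesgue. hom_ext f (vector_derivative \<alpha> (at t within {0..1}))))"
    then show "\<mu> = ?S"
      using S S_integral closed_proj_space_peak_function
      by (intro finite_borel_measure_eqI_continuous) simp_all
  qed (use S S_integral in blast)
qed

end
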